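(* Let $m_0>1$. Then $N_{max}^{MCLS}\le N_{max}^{FCLS}=\lceil m_0^2\rceil$.
   Context: $\lceil x\rceil$ denotes the smallest integer greater than or equal to $x$, and $\mathbb{N}$ is the set of natural numbers. For $m_0>1$, consider the recursion with $b_0=m_0$ and $$b_{t+1}=g(b_t),\qquad g(b_t)=\frac{b_t(b_t-1)}{\sqrt{1+b_t^2}-1},$$ and define $N_{max}^{MCLS}=\min\{t\in\mathbb{N}: b_t<0\}$, which is a function of $m_0$. Interpretation: in the discrete-time lion and man game in the non-negative quadrant with unit step length, $m_0$ is the smallest coordinate of the initial center, $N_{max}^{MCLS}$ is the upper bound on the number of moves needed for capture by the lion strategy that recomputes the center at each move (Moving Center Lion Strategy), and $N_{max}^{FCLS}=\lceil m_0^2\rceil$ is the known upper bound for the strategy whose center is fixed at the beginning of the game (Fixed Center Lion Strategy).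
   Formalization: For some m_0>1 the sequence reaches b_t=0, where g is undefined (0/0) and no negative term would exist; here g(0) is taken to be its right-hand limit, minus infinity, so the next term counts as negative. For all other m_0 the sequence is unchanged. *)

theory Defs
  imports "HOL-Library.Extended_Real" "HOL-Real_Asymp.Real_Asymp"
begin

definition mcls_g :: "real \<Rightarrow> real" where
  "mcls_g b = b * (b - 1) / (sqrt (1 + b\<^sup>2) - 1)"

text \<open>
  The formula for the step function is undefined (0/0) at 0, and 0 is reached: if some b(t) = 1
  then b(t+1) = 0.  With the convention x / 0 = 0 such a sequence would stay at 0 forever
  and never become negative.  The step function is therefore completed at 0 by its limit from the
  right, minus infinity (\<open>mcls_g_at_right_0\<close> below); the sequence lives in the extended reals for
  this reason only.  When 0 is never reached, it is the plain real sequence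
  (\<open>mcls_seq_eq_real\<close> below).  The values of the step at the infinities are irrelevant:
  plus infinity never occurs, and minus infinity is already negative.
\<close>

definition mcls_step :: "ereal \<Rightarrow> ereal" where
  "mcls_step x = (case x of ereal b \<Rightarrow> if b = 0 then - \<infinity> else ereal (mcls_g b) | _ \<Rightarrow> - \<infinity>)"

primrec mcls_seq :: "real \<Rightarrow> nat \<Rightarrow> ereal" where
  "mcls_seq m0 0 = ereal m0"
| "mcls_seq m0 (Suc t) = mcls_step (mcls_seq m0 t)"

text \<open>
  The minimum over t; it is meaningful only if some term is negative, so results about it have
  to state existence as well.
\<close>

definition N_max_MCLS :: "real \<Rightarrow> nat" where
  "N_max_MCLS m0 = (LEAST t. mcls_seq m0 t < 0)"

definition N_max_FCLS :: "real \<Rightarrow> int" where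
  "N_max_FCLS m0 = \<lceil>m0\<^sup>2\<rceil>"

lemma mcls_g_at_right_0: "filterlim mcls_g at_bot (at_right 0)"
  unfolding mcls_g_def by real_asymp

lemma mcls_seq_eq_real:
  fixes b :: "nat \<Rightarrow> real"
  assumes "b 0 = m0" and "\<And>t. b (Suc t) = mcls_g (b t)" and "\<And>t. b t \<noteq> 0"
  shows "mcls_seq m0 t = ereal (b t)"
  using assms by (induction t) (simp_all add: mcls_step_def)

end

theory Submission
  imports Defs
begin

text \<open>
  For \<open>b > 1\<close> the step satisfies \<open>0 < g b\<close> and \<open>(g b)\<^sup>2 < b\<^sup>2 - 1\<close>, so the square drops by at least 1
  per move until the sequence falls below 1, after which the next term is negative. The strict
  drop at the first move rules out hitting 1 exactly at the last moment, which would cost one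
  move more than \<open>\<lceil>m0\<^sup>2\<rceil>\<close>.
\<close>

text \<open>Multiplying by the conjugate clears the root from the denominator, since
  \<open>(s - 1) * (s + 1) = b\<^sup>2\<close> for the root \<open>s\<close>. For
  \<open>b > 0\<close> the sign is then that of \<open>b - 1\<close>.\<close>

lemma mcls_g_alt:
  assumes "b \<noteq> 0"
  shows "mcls_g b = (b - 1) * (sqrt (1 + b\<^sup>2) + 1) / b"
proof -
  define s where "s = sqrt (1 + b\<^sup>2)"
  have "s\<^sup>2 = 1 + b\<^sup>2"
    unfolding s_def by (simp add: add_nonneg_nonneg)
  then have b2: "(s - 1) * (s + 1) = b * b"
    by (simp add: algebra_simps power2_eq_square)
  with assms have "s - 1 \<noteq> 0"
    by auto
  moreover have "b * (b - 1) * b = (b - 1) * (s + 1) * (s - 1)"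
    using b2 by (simp add: algebra_simps)
  ultimately show ?thesis
    using assms unfolding mcls_g_def s_def [symmetric] by (simp add: frac_eq_eq)
qed

lemma mcls_g_neg:
  assumes "0 < b" "b < 1"
  shows "mcls_g b < 0"
  using assms by (auto simp: mcls_g_alt divide_less_0_iff intro!: mult_neg_pos add_nonneg_pos)

lemma mcls_g_nonneg:
  assumes "1 \<le> b"
  shows "0 \<le> mcls_g b"
  using assms by (simp add: mcls_g_alt)

text \<open>Isolates the excess over a drop of 1: as \<open>s > b\<close>, the subtracted fraction
  has the sign of \<open>b - 1\<close>, which yields both the weak and the strict bound.\<close>

lemma mcls_g_power2:
  assumes "b \<noteq> 0"
  defines "s \<equiv> sqrt (1 + b\<^sup>2)"
  shows "(mcls_g b)\<^sup>2 = b\<^sup>2 - 1 - 2 * (b - 1) * (s + 1) * (s - b) / b\<^sup>2"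
proof -
  have "s\<^sup>2 = 1 + b\<^sup>2"
    unfolding s_def by (simp add: add_nonneg_nonneg)
  then have "((b - 1) * (s + 1))\<^sup>2 = (b\<^sup>2 - 1) * b\<^sup>2 - 2 * (b - 1) * (s + 1) * (s - b)"
    by algebra
  with assms(1) show ?thesis
    by (simp add: mcls_g_alt s_def [symmetric] power_divide diff_divide_distrib)
qed

lemma less_sqrt_one_plus_power2: "b < sqrt (1 + b\<^sup>2)" for b :: real
  by (simp add: real_less_rsqrt)

lemma mcls_g_power2_le:
  assumes "1 \<le> b"
  shows "(mcls_g b)\<^sup>2 \<le> b\<^sup>2 - 1"
  using assms less_sqrt_one_plus_power2 [of b] by (simp add: mcls_g_power2)

lemma mcls_g_power2_less:
  assumes "1 < b"
  shows "(mcls_g b)\<^sup>2 < b\<^sup>2 - 1"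
  using assms less_sqrt_one_plus_power2 [of b] by (simp add: mcls_g_power2)

text \<open>Peels off the first move instead of the last, so that an induction can restart from
  \<open>mcls_g b\<close>.\<close>

lemma mcls_seq_Suc_shift:
  assumes "b \<noteq> 0"
  shows "mcls_seq b (Suc t) = mcls_seq (mcls_g b) t"
  using assms by (induction t) (simp_all add: mcls_step_def)

lemma mcls_seq_eventually_neg:
  assumes "0 \<le> b" "b\<^sup>2 < real n"
  shows "\<exists>t\<le>n. mcls_seq b t < 0"
  using assms
proof (induction n arbitrary: b)
  case 0
  then show ?case by simp
next
  case (Suc n)
  show ?case
  proof (cases "b < 1")
    case True
    \<comment> \<open>This includes \<open>b = 0\<close>, where the step is minus infinity by
      definition.\<close>
    with Suc.prems have "mcls_seq b (Suc 0) < 0"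
      by (simp add: mcls_step_def mcls_g_neg)
    then show ?thesis by (metis Suc_le_mono le0)
  next
    case False
    with Suc.prems have "(mcls_g b)\<^sup>2 < real n"
      using mcls_g_power2_le [of b] by simp
    with Suc.IH mcls_g_nonneg [of b] False
    obtain t where "t \<le> n" "mcls_seq (mcls_g b) t < 0"
      by auto
    with False have "Suc t \<le> Suc n" "mcls_seq b (Suc t) < 0"
      by (simp_all add: mcls_seq_Suc_shift del: mcls_seq.simps)
    then show ?thesis by blast
  qed
qed

theorem theorem2:
  fixes m0 :: real
  assumes "m0 > 1"
  shows "(\<exists>t. mcls_seq m0 t < 0) \<and>
    int (N_max_MCLS m0) \<le> N_max_FCLS m0 \<and> N_max_FCLS m0 = \<lceil>m0\<^sup>2\<rceil>"
proof -
  define n where "n = nat (\<lceil>m0\<^sup>2\<rceil> - 1)"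
  have "1 < m0\<^sup>2"
    using assms by simp
  then have n: "int (Suc n) = \<lceil>m0\<^sup>2\<rceil>"
    unfolding n_def by linarith
  then have "m0\<^sup>2 \<le> real (Suc n)"
    by linarith
  \<comment> \<open>If \<open>m0\<^sup>2\<close> is an integer, it equals \<open>Suc n\<close>; only
    the strict drop then gives the strict inequality that \<open>mcls_seq_eventually_neg\<close>
    requires.\<close>
  with mcls_g_power2_less [OF assms] have "(mcls_g m0)\<^sup>2 < real n"
    by simp
  with mcls_seq_eventually_neg mcls_g_nonneg [of m0] assms
  obtain t where t: "t \<le> n" "mcls_seq (mcls_g m0) t < 0"
    by auto
  with assms have neg: "mcls_seq m0 (Suc t) < 0"
    by (simp add: mcls_seq_Suc_shift del: mcls_seq.simps)
  then have "N_max_MCLS m0 \<le> Suc t"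
    unfolding N_max_MCLS_def by (rule Least_le)
  with t(1) n have "int (N_max_MCLS m0) \<le> \<lceil>m0\<^sup>2\<rceil>"
    by linarith
  with neg show ?thesis
    unfolding N_max_FCLS_def by blast
qed

end
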